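(* If $G$ is a forest, then $\mathcal{R}(G)$ is connected.
   Context: All graphs are finite, simple and undirected; $N(v)$ denotes the open neighbourhood of $v$. A set $S\subseteq V(G)$ is a dominating set if every vertex of $G$ is in $S$ or adjacent to a vertex of $S$; it is a minimal dominating set if no proper subset of $S$ is a dominating set. The reconfiguration graph $\mathcal{R}(G)$ has as vertex set the collection of all minimal dominating sets of $G$, and two minimal dominating sets $M_1,M_2$ are adjacent iff there is a vertex $v$ with either ($M_2\setminus M_1=\{v\}$ and $M_1\setminus M_2\subseteq N(v)$) or ($M_1\setminus M_2=\{v\}$ and $M_2\setminus M_1\subseteq N(v)$). *)

theory Defs
  imports "Graph_Theory.Graph_Theory"
begin

text \<open>
  A finite simple undirected graph is a \<^locale>\<open>pair_graph\<close>: a finite, loop-free, symmetric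
  digraph whose arcs are pairs of vertices.
\<close>

definition nbhd :: "'a pair_pre_digraph \<Rightarrow> 'a \<Rightarrow> 'a set" where
  "nbhd G v = {w. (v, w) \<in> parcs G}"

definition dominating_set :: "'a pair_pre_digraph \<Rightarrow> 'a set \<Rightarrow> bool" where
  "dominating_set G S \<longleftrightarrow>
     S \<subseteq> pverts G \<and> (\<forall>v \<in> pverts G. v \<in> S \<or> (\<exists>u \<in> S. v \<in> nbhd G u))"

definition minimal_dominating_set :: "'a pair_pre_digraph \<Rightarrow> 'a set \<Rightarrow> bool" where
  "minimal_dominating_set G S \<longleftrightarrow>
     dominating_set G S \<and> \<not> (\<exists>T. T \<subset> S \<and> dominating_set G T)"

definition reconfig_adj :: "'a pair_pre_digraph \<Rightarrow> 'a set \<Rightarrow> 'a set \<Rightarrow> bool" where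
  "reconfig_adj G M1 M2 \<longleftrightarrow>
     (\<exists>v. (M2 - M1 = {v} \<and> M1 - M2 \<subseteq> nbhd G v) \<or> (M1 - M2 = {v} \<and> M2 - M1 \<subseteq> nbhd G v))"

definition reconfig_graph :: "'a pair_pre_digraph \<Rightarrow> 'a set pair_pre_digraph" where
  "reconfig_graph G =
     \<lparr> pverts = {M. minimal_dominating_set G M},
       parcs = {(M1, M2). minimal_dominating_set G M1 \<and> minimal_dominating_set G M2 \<and>
                  reconfig_adj G M1 M2} \<rparr>"

text \<open>
  The library's \<^const>\<open>forest\<close> is about directed cycles, and in a symmetric digraph
  every edge \<open>{u, v}\<close> yields the directed cycle \<open>u, v, u\<close>. The cycles of the undirected
  graph are the directed cycles of length at least three.
\<close>

definition undirected_forest :: "'a pair_pre_digraph \<Rightarrow> bool" where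
  "undirected_forest G \<longleftrightarrow> \<not> (\<exists>p. pre_digraph.cycle (with_proj G) p \<and> 3 \<le> length p)"

lemma pair_graph_reconfig_graph:
  assumes "pair_graph G"
  shows "pair_graph (reconfig_graph G)"
proof -
  interpret pair_graph G by (rule assms)
  have "finite (Pow (pverts G))"
    using pair_finite_verts by simp
  then have fin: "finite {M. minimal_dominating_set G M}"
    by (rule rev_finite_subset) (auto simp: minimal_dominating_set_def dominating_set_def)
  have "parcs (reconfig_graph G) \<subseteq> {M. minimal_dominating_set G M} \<times> {M. minimal_dominating_set G M}"
    by (auto simp: reconfig_graph_def)
  then have "finite (parcs (reconfig_graph G))"
    by (rule finite_subset) (intro finite_cartesian_product fin)
  then show ?thesis
    using fin
    by unfold_locales
      (auto simp: reconfig_graph_def symmetric_def sym_def reconfig_adj_def)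
qed

end

theory Submission
  imports Defs
begin

text \<open>
  A forest with an edge has a vertex \<open>p\<close> with a nonempty set \<open>L\<close> of leaf neighbours and at most one
  further neighbour \<open>q\<close>. A minimal dominating set meets \<open>L \<union> {p}\<close> in exactly \<open>L\<close> or exactly \<open>{p}\<close>.
  Those of the first kind correspond to the minimal dominating sets of \<open>G - L - p\<close>, and those of the
  second kind avoiding \<open>q\<close> to the minimal dominating sets of \<open>G - L - p - q\<close>; by induction, each of
  these two classes lies in one component. If \<open>p \<in> M\<close> and \<open>q\<close> is dominated by \<open>M - {p}\<close> (or does not
  exist), then replacing \<open>p\<close> by \<open>L\<close> is a legal move. This settles \<open>q \<in> M\<close>, and it links
  the two classes when \<open>M - {p}\<close> is a maximal independent set of \<open>G - L - p - q\<close> containing a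
  neighbour of \<open>q\<close>.

  The subgraph induced by \<open>V\<close> is represented by \<open>G\<lparr>pverts := V\<rparr>\<close>, which keeps all arcs of \<open>G\<close>: arcs
  leaving \<open>V\<close> do not affect domination within \<open>V\<close>, and reconfiguration adjacency ignores the
  vertex set.
\<close>

section \<open>Domination in induced subgraphs\<close>

definition closed_nbhd :: "'a pair_pre_digraph \<Rightarrow> 'a \<Rightarrow> 'a set" where
  "closed_nbhd G v = insert v (nbhd G v)"

lemma dominating_set_pverts_update:
  "dominating_set (G\<lparr>pverts := V\<rparr>) S \<longleftrightarrow>
     S \<subseteq> V \<and> (\<forall>v \<in> V. \<exists>u \<in> S. v \<in> closed_nbhd G u)"
  by (auto simp: dominating_set_def closed_nbhd_def nbhd_def)

text \<open>Domination is monotone, so minimality need only be tested by deleting single vertices.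
  Deleting \<open>s\<close> destroys domination exactly if some \<open>x\<close>, possibly
  \<open>s\<close> itself, is a private neighbour of \<open>s\<close>.\<close>

lemma minimal_dominating_set_pverts_update:
  "minimal_dominating_set (G\<lparr>pverts := V\<rparr>) S \<longleftrightarrow>
     S \<subseteq> V \<and> (\<forall>v \<in> V. \<exists>u \<in> S. v \<in> closed_nbhd G u) \<and>
     (\<forall>s \<in> S. \<exists>x \<in> V. x \<in> closed_nbhd G s \<and> (\<forall>u \<in> S. x \<in> closed_nbhd G u \<longrightarrow> u = s))"
  (is "?L \<longleftrightarrow> ?sub \<and> ?dom \<and> ?priv")
proof (intro iffI conjI)
  assume L: ?L
  then show sub: ?sub and dom: ?dom
    by (auto simp: minimal_dominating_set_def dominating_set_pverts_update)
  show ?priv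
  proof
    fix s assume s: "s \<in> S"
    then have "S - {s} \<subset> S" by auto
    with L have "\<not> dominating_set (G\<lparr>pverts := V\<rparr>) (S - {s})"
      by (auto simp: minimal_dominating_set_def)
    with sub obtain x where x: "x \<in> V" "\<forall>u \<in> S - {s}. x \<notin> closed_nbhd G u"
      by (auto simp: dominating_set_pverts_update)
    with dom s show "\<exists>x \<in> V. x \<in> closed_nbhd G s \<and> (\<forall>u \<in> S. x \<in> closed_nbhd G u \<longrightarrow> u = s)" by blast
  qed
next
  assume R: "?sub \<and> ?dom \<and> ?priv"
  have "\<not> dominating_set (G\<lparr>pverts := V\<rparr>) T" if T: "T \<subset> S" for T
  proof -
    from T obtain s where "s \<in> S" "s \<notin> T" by auto
    with R obtain x where "x \<in> V" "x \<in> closed_nbhd G s \<and> (\<forall>u \<in> S. x \<in> closed_nbhd G u \<longrightarrow> u = s)" by meson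
    with T \<open>s \<notin> T\<close> show ?thesis
      unfolding dominating_set_pverts_update by (metis psubset_imp_subset subsetD)
  qed
  with R show ?L by (auto simp: minimal_dominating_set_def dominating_set_pverts_update)
qed

section \<open>Reachability by reconfiguration moves\<close>

text \<open>A closure of a relation on sets, because the record with updated \<open>pverts\<close>
  need not be a well-formed digraph.\<close>

definition reconfig_reachable :: "'a pair_pre_digraph \<Rightarrow> 'a set \<Rightarrow> 'a set \<Rightarrow> bool" where
  "reconfig_reachable G =
     (\<lambda>M N. minimal_dominating_set G M \<and> minimal_dominating_set G N \<and> reconfig_adj G M N)\<^sup>*\<^sup>*"

lemma reconfig_adj_pverts_update [simp]: "reconfig_adj (G\<lparr>pverts := V\<rparr>) = reconfig_adj G"
  by (auto simp: reconfig_adj_def nbhd_def fun_eq_iff)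

lemma reconfig_adj_sym: "reconfig_adj G M N \<Longrightarrow> reconfig_adj G N M"
  by (auto simp: reconfig_adj_def)

lemma reconfig_reachable_refl [simp]: "reconfig_reachable G M M"
  by (simp add: reconfig_reachable_def)

lemma reconfig_reachable_trans:
  "reconfig_reachable G M N \<Longrightarrow> reconfig_reachable G N K \<Longrightarrow> reconfig_reachable G M K"
  by (simp add: reconfig_reachable_def)

lemma reconfig_reachable_sym:
  assumes "reconfig_reachable G M N"
  shows "reconfig_reachable G N M"
proof -
  have "symp (\<lambda>M N. minimal_dominating_set G M \<and> minimal_dominating_set G N \<and> reconfig_adj G M N)"
    by (auto intro!: sympI reconfig_adj_sym)
  from symp_rtranclp[OF this] assms show ?thesis
    unfolding reconfig_reachable_def by (rule sympD)
qed

text \<open>Paths lift from a smaller subgraph: adding a fixed set \<open>A\<close> disjoint from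
  \<open>W\<close> changes neither difference of two consecutive sets.\<close>

lemma reconfig_reachable_Un:
  assumes "reconfig_reachable (G\<lparr>pverts := W\<rparr>) M N"
    and mds: "\<And>K. minimal_dominating_set (G\<lparr>pverts := W\<rparr>) K \<Longrightarrow>
      minimal_dominating_set (G\<lparr>pverts := V\<rparr>) (K \<union> A)"
    and "A \<inter> W = {}"
  shows "reconfig_reachable (G\<lparr>pverts := V\<rparr>) (M \<union> A) (N \<union> A)"
  using assms(1) unfolding reconfig_reachable_def
proof (induction rule: rtranclp_induct)
  case (step N K)
  then have "N \<subseteq> W" "K \<subseteq> W"
    by (auto simp: minimal_dominating_set_pverts_update)
  with \<open>A \<inter> W = {}\<close> have "N \<union> A - (K \<union> A) = N - K" "K \<union> A - (N \<union> A) = K - N" by auto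
  with step.hyps(2) have "reconfig_adj G (N \<union> A) (K \<union> A)"
    unfolding reconfig_adj_pverts_update reconfig_adj_def by simp
  with step.hyps(2) show ?case
    by (intro rtranclp.rtrancl_into_rtrancl[OF step.IH]) (auto intro: mds)
qed simp

section \<open>Existence of minimal dominating sets\<close>

context pair_graph
begin

lemma nbhd_sym: "x \<in> nbhd G y \<longleftrightarrow> y \<in> nbhd G x"
  by (auto simp: nbhd_def intro: arcs_symmetric)

lemma not_in_nbhd_self: "x \<notin> nbhd G x"
  by (auto simp: nbhd_def dest: no_loops')

text \<open>A maximal independent set is a minimal dominating set.\<close>

lemma ex_minimal_dominating_set_containing:
  assumes "finite V" "r \<in> V"
  shows "\<exists>M. minimal_dominating_set (G\<lparr>pverts := V\<rparr>) M \<and> r \<in> M"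
proof -
  define I where "I = {S. S \<subseteq> V \<and> r \<in> S \<and> (\<forall>x \<in> S. \<forall>y \<in> S. x \<notin> nbhd G y)}"
  have "I \<subseteq> Pow V" by (auto simp: I_def)
  then have "finite I" using assms(1) by (meson finite_Pow_iff finite_subset)
  moreover have "{r} \<in> I" using assms(2) not_in_nbhd_self by (auto simp: I_def)
  ultimately obtain M where M: "M \<in> I" and max: "\<And>S. S \<in> I \<Longrightarrow> M \<subseteq> S \<Longrightarrow> S = M"
    using finite_has_maximal[of I] by blast
  have "\<exists>u \<in> M. v \<in> closed_nbhd G u" if "v \<in> V" for v
  proof (rule ccontr)
    assume *: "\<not> ?thesis"
    then have "insert v M \<in> I"
      using M that nbhd_sym not_in_nbhd_self by (auto simp: I_def closed_nbhd_def)
    then have "insert v M = M" using max by blast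
    with * show False by (auto simp: closed_nbhd_def)
  qed
  \<comment> \<open>By independence, each \<open>s\<close> in \<open>M\<close> is its own private
    neighbour.\<close>
  moreover have "\<exists>x \<in> V. x \<in> closed_nbhd G s \<and> (\<forall>u \<in> M. x \<in> closed_nbhd G u \<longrightarrow> u = s)" if "s \<in> M" for s
    using M that by (intro bexI[of _ s]) (auto simp: I_def closed_nbhd_def)
  ultimately have "minimal_dominating_set (G\<lparr>pverts := V\<rparr>) M"
    using M by (auto simp: minimal_dominating_set_pverts_update I_def)
  with M show ?thesis by (auto simp: I_def)
qed

lemma ex_minimal_dominating_set:
  assumes "finite V"
  shows "\<exists>M. minimal_dominating_set (G\<lparr>pverts := V\<rparr>) M"
proof (cases "V = {}")
  case True
  then show ?thesis by (auto simp: minimal_dominating_set_pverts_update)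
next
  case False
  with assms show ?thesis using ex_minimal_dominating_set_containing by blast
qed

end

section \<open>Minimal dominating sets around a pendant star\<close>

locale pendant_star = pair_graph G for G :: "'a pair_pre_digraph" +
  fixes V L :: "'a set" and p :: 'a
  assumes p_in: "p \<in> V" and p_notin: "p \<notin> L" and L_sub: "L \<subseteq> V" and L_ne: "L \<noteq> {}"
    and leaf: "\<And>l x. l \<in> L \<Longrightarrow> x \<in> V \<Longrightarrow> x \<in> nbhd G l \<longleftrightarrow> x = p"
begin

abbreviation mds :: "'a set \<Rightarrow> 'a set \<Rightarrow> bool" where
  "mds W \<equiv> minimal_dominating_set (G\<lparr>pverts := W\<rparr>)"

lemma closed_nbhd_leaf: "l \<in> L \<Longrightarrow> x \<in> V \<Longrightarrow> x \<in> closed_nbhd G l \<longleftrightarrow> x = l \<or> x = p"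
  using leaf by (auto simp: closed_nbhd_def)

lemma leaf_in_closed_nbhd: "l \<in> L \<Longrightarrow> x \<in> V \<Longrightarrow> l \<in> closed_nbhd G x \<longleftrightarrow> x = l \<or> x = p"
  using closed_nbhd_leaf nbhd_sym by (auto simp: closed_nbhd_def)

lemma self_in_closed_nbhd: "x \<in> closed_nbhd G x"
  by (simp add: closed_nbhd_def)

text \<open>A leaf \<open>l\<close> dominates only \<open>l\<close> and \<open>p\<close>, and
  \<open>p\<close> dominates both, so \<open>l\<close> has no private neighbour.\<close>

lemma leaf_notin_mds:
  assumes "mds V M" "p \<in> M"
  shows "M \<inter> L = {}"
proof (rule ccontr)
  assume "M \<inter> L \<noteq> {}"
  then obtain l where l: "l \<in> M" "l \<in> L" by auto
  with assms obtain x where x: "x \<in> V" "x \<in> closed_nbhd G l \<and> (\<forall>u \<in> M. x \<in> closed_nbhd G u \<longrightarrow> u = l)"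
    unfolding minimal_dominating_set_pverts_update by meson
  then have "x = l \<or> x = p" using l closed_nbhd_leaf by blast
  moreover have "l \<noteq> p" using l p_notin by auto
  ultimately show False
    using x(2) assms(2) leaf_in_closed_nbhd[OF l(2) p_in] self_in_closed_nbhd[of p] by auto
qed

lemma leaves_subset_mds:
  assumes "mds V M" "p \<notin> M"
  shows "L \<subseteq> M"
proof
  fix l assume l: "l \<in> L"
  with assms(1) L_sub obtain u where "u \<in> M" "u \<in> V" "l \<in> closed_nbhd G u"
    unfolding minimal_dominating_set_pverts_update by (meson subsetD)
  with l assms(2) show "l \<in> M" using leaf_in_closed_nbhd by blast
qed

text \<open>Inside \<open>V\<close> the leaves dominate exactly \<open>L\<close> and
  \<open>p\<close>, so they take no private neighbour away from \<open>N\<close>; each leaf is its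
  own private neighbour.\<close>

lemma mds_Un_leaves:
  assumes "mds (V - L - {p}) N"
  shows "mds V (N \<union> L)"
  unfolding minimal_dominating_set_pverts_update
proof (intro conjI ballI)
  have N: "N \<subseteq> V - L - {p}" using assms by (simp add: minimal_dominating_set_pverts_update)
  then show "N \<union> L \<subseteq> V" using L_sub by auto
  show "\<exists>u \<in> N \<union> L. v \<in> closed_nbhd G u" if "v \<in> V" for v
  proof (cases "v \<in> L \<or> v = p")
    case True
    with that L_ne closed_nbhd_leaf show ?thesis by blast
  next
    case False
    with that assms show ?thesis unfolding minimal_dominating_set_pverts_update by blast
  qed
  fix s assume "s \<in> N \<union> L"
  then show "\<exists>x \<in> V. x \<in> closed_nbhd G s \<and> (\<forall>u \<in> N \<union> L. x \<in> closed_nbhd G u \<longrightarrow> u = s)"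
  proof
    assume "s \<in> L"
    then show ?thesis using N L_sub p_notin leaf_in_closed_nbhd by (intro bexI[of _ s]) blast+
  next
    assume s: "s \<in> N"
    with assms obtain x where "x \<in> V - L - {p}" "x \<in> closed_nbhd G s \<and> (\<forall>u \<in> N. x \<in> closed_nbhd G u \<longrightarrow> u = s)"
      unfolding minimal_dominating_set_pverts_update by meson
    then show ?thesis using s N closed_nbhd_leaf by (intro bexI[of _ x]) blast+
  qed
qed

lemma mds_Diff_leaves:
  assumes "mds V M" "p \<notin> M"
  shows "mds (V - L - {p}) (M - L)"
  unfolding minimal_dominating_set_pverts_update
proof (intro conjI ballI)
  have M: "M \<subseteq> V" using assms by (simp add: minimal_dominating_set_pverts_update)
  have L: "L \<subseteq> M" by (rule leaves_subset_mds[OF assms])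
  show "M - L \<subseteq> V - L - {p}" using M assms(2) by auto
  show "\<exists>u \<in> M - L. v \<in> closed_nbhd G u" if v: "v \<in> V - L - {p}" for v
  proof -
    from v assms obtain u where "u \<in> M" "v \<in> closed_nbhd G u"
      unfolding minimal_dominating_set_pverts_update by blast
    with v show ?thesis using closed_nbhd_leaf by blast
  qed
  fix s assume s: "s \<in> M - L"
  with assms obtain x where x: "x \<in> V" "x \<in> closed_nbhd G s \<and> (\<forall>u \<in> M. x \<in> closed_nbhd G u \<longrightarrow> u = s)"
    unfolding minimal_dominating_set_pverts_update by (meson DiffD1)
  \<comment> \<open>The leaves lie in \<open>M\<close> and dominate themselves and
    \<open>p\<close>.\<close>
  then have "x \<notin> L" "x \<noteq> p"
    using s L L_ne closed_nbhd_leaf by blast+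
  with x show "\<exists>x \<in> V - L - {p}. x \<in> closed_nbhd G s \<and> (\<forall>u \<in> M - L. x \<in> closed_nbhd G u \<longrightarrow> u = s)" by blast
qed

text \<open>By \<open>other\<close>, \<open>p\<close> is dispensable outside the star. Since
  \<open>p\<close> dominates the star, private neighbours of the other vertices lie outside it,
  where the new leaves dominate nothing.\<close>

lemma mds_exchange:
  assumes "mds V M" "p \<in> M"
    and other: "\<And>x. x \<in> V - L \<Longrightarrow> x \<in> nbhd G p \<Longrightarrow> \<exists>t \<in> M - {p}. x \<in> closed_nbhd G t"
  shows "mds V ((M - {p}) \<union> L)" and "reconfig_adj G M ((M - {p}) \<union> L)"
proof -
  have M: "M \<subseteq> V" using assms by (simp add: minimal_dominating_set_pverts_update)
  have L: "M \<inter> L = {}" by (rule leaf_notin_mds[OF assms(1,2)])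
  have "M - ((M - {p}) \<union> L) = {p}" using p_notin assms(2) by auto
  moreover have "(M - {p}) \<union> L - M \<subseteq> nbhd G p" using leaf p_in nbhd_sym by blast
  ultimately show "reconfig_adj G M ((M - {p}) \<union> L)" by (auto simp: reconfig_adj_def)
  show "mds V ((M - {p}) \<union> L)"
    unfolding minimal_dominating_set_pverts_update
  proof (intro conjI ballI)
    show "M - {p} \<union> L \<subseteq> V" using M L_sub by auto
    show "\<exists>u \<in> M - {p} \<union> L. v \<in> closed_nbhd G u" if v: "v \<in> V" for v
    proof (cases "v \<in> L \<or> v = p")
      case True
      with v L_ne closed_nbhd_leaf show ?thesis by blast
    next
      case False
      from v assms obtain u where "u \<in> M" "v \<in> closed_nbhd G u"
        unfolding minimal_dominating_set_pverts_update by blast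
      with False v other[of v] show ?thesis by (cases "u = p") (auto simp: closed_nbhd_def)
    qed
    fix s assume "s \<in> M - {p} \<union> L"
    then show "\<exists>x \<in> V. x \<in> closed_nbhd G s \<and> (\<forall>u \<in> M - {p} \<union> L. x \<in> closed_nbhd G u \<longrightarrow> u = s)"
    proof
      assume "s \<in> L"
      then show ?thesis using M L_sub p_notin leaf_in_closed_nbhd by (intro bexI[of _ s]) blast+
    next
      assume s: "s \<in> M - {p}"
      with assms obtain x where x: "x \<in> V" "x \<in> closed_nbhd G s \<and> (\<forall>u \<in> M. x \<in> closed_nbhd G u \<longrightarrow> u = s)"
        unfolding minimal_dominating_set_pverts_update by (meson DiffD1)
      then have "x \<notin> L" "x \<noteq> p"
        using s assms(2) leaf_in_closed_nbhd[OF _ p_in] self_in_closed_nbhd[of p] by auto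
      with x s L show ?thesis using closed_nbhd_leaf by (intro bexI[of _ x]) blast+
    qed
  qed
qed

context
  fixes q :: 'a
  assumes q: "q \<in> V - L" "q \<in> nbhd G p"
    and only: "\<And>x. x \<in> V - L \<Longrightarrow> x \<in> nbhd G p \<Longrightarrow> x = q"
begin

lemma closed_nbhd_centre: "x \<in> V - L - {p, q} \<Longrightarrow> x \<notin> closed_nbhd G p"
  using only by (auto simp: closed_nbhd_def)

text \<open>Inside \<open>V\<close>, \<open>p\<close> dominates exactly \<open>L\<close>,
  \<open>p\<close> and \<open>q\<close>, so \<open>N\<close> keeps its private neighbours and need
  not dominate \<open>q\<close>. Any leaf is private to \<open>p\<close>.\<close>

lemma mds_insert_centre:
  assumes "mds (V - L - {p, q}) N"
  shows "mds V (N \<union> {p})"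
  unfolding minimal_dominating_set_pverts_update
proof (intro conjI ballI)
  have N: "N \<subseteq> V - L - {p, q}" using assms by (simp add: minimal_dominating_set_pverts_update)
  then show "N \<union> {p} \<subseteq> V" using p_in by auto
  show "\<exists>u \<in> N \<union> {p}. v \<in> closed_nbhd G u" if "v \<in> V" for v
  proof (cases "v \<in> L \<or> v = p \<or> v = q")
    case True
    with that q leaf_in_closed_nbhd[OF _ p_in] show ?thesis by (auto simp: closed_nbhd_def)
  next
    case False
    with that assms show ?thesis unfolding minimal_dominating_set_pverts_update by blast
  qed
  fix s assume "s \<in> N \<union> {p}"
  then show "\<exists>x \<in> V. x \<in> closed_nbhd G s \<and> (\<forall>u \<in> N \<union> {p}. x \<in> closed_nbhd G u \<longrightarrow> u = s)"
  proof
    assume "s \<in> {p}"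
    moreover obtain l where "l \<in> L" using L_ne by auto
    ultimately show ?thesis
      using N L_sub p_in leaf_in_closed_nbhd by (intro bexI[of _ l]) blast+
  next
    assume s: "s \<in> N"
    with assms obtain x where "x \<in> V - L - {p, q}" "x \<in> closed_nbhd G s \<and> (\<forall>u \<in> N. x \<in> closed_nbhd G u \<longrightarrow> u = s)"
      unfolding minimal_dominating_set_pverts_update by meson
    then show ?thesis using s N closed_nbhd_centre by (intro bexI[of _ x]) blast+
  qed
qed

lemma mds_Diff_centre:
  assumes "mds V M" "p \<in> M" "q \<notin> M"
  shows "mds (V - L - {p, q}) (M - {p})"
  unfolding minimal_dominating_set_pverts_update
proof (intro conjI ballI)
  have M: "M \<subseteq> V" using assms by (simp add: minimal_dominating_set_pverts_update)
  have L: "M \<inter> L = {}" by (rule leaf_notin_mds[OF assms(1,2)])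
  show "M - {p} \<subseteq> V - L - {p, q}" using M L assms(3) by auto
  show "\<exists>u \<in> M - {p}. v \<in> closed_nbhd G u" if v: "v \<in> V - L - {p, q}" for v
  proof -
    from v assms obtain u where "u \<in> M" "v \<in> closed_nbhd G u"
      unfolding minimal_dominating_set_pverts_update by blast
    with v show ?thesis using closed_nbhd_centre by blast
  qed
  fix s assume s: "s \<in> M - {p}"
  with assms obtain x where x: "x \<in> V" "x \<in> closed_nbhd G s \<and> (\<forall>u \<in> M. x \<in> closed_nbhd G u \<longrightarrow> u = s)"
    unfolding minimal_dominating_set_pverts_update by (meson DiffD1)
  then have "x \<notin> closed_nbhd G p" using s assms(2) by blast
  \<comment> \<open>All of these are dominated by \<open>p\<close>.\<close>
  then have "x \<notin> L" "x \<noteq> p" "x \<noteq> q"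
    using q leaf_in_closed_nbhd[OF _ p_in] by (auto simp: closed_nbhd_def)
  with x show "\<exists>x \<in> V - L - {p, q}. x \<in> closed_nbhd G s \<and> (\<forall>u \<in> M - {p}. x \<in> closed_nbhd G u \<longrightarrow> u = s)" by blast
qed

end

text \<open>By symmetry it suffices to lead each set to one avoiding \<open>p\<close>, since
  \<open>IH\<close> for \<open>V - L - {p}\<close> connects those. The hypothesis
  \<open>nonleaf\<close> provides a dominator of the further neighbour that is not
  \<open>p\<close>.\<close>

lemma reconfig_reachable_step:
  assumes "finite V"
    and only: "\<And>x y. x \<in> V - L \<Longrightarrow> x \<in> nbhd G p \<Longrightarrow> y \<in> V - L \<Longrightarrow> y \<in> nbhd G p \<Longrightarrow> x = y"
    and nonleaf: "\<And>x. x \<in> V - L \<Longrightarrow> x \<in> nbhd G p \<Longrightarrow> \<exists>r \<in> V - {p}. r \<in> nbhd G x"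
    and IH: "\<And>W M N. W \<subset> V \<Longrightarrow> mds W M \<Longrightarrow> mds W N \<Longrightarrow>
      reconfig_reachable (G\<lparr>pverts := W\<rparr>) M N"
    and "mds V M" "mds V N"
  shows "reconfig_reachable (G\<lparr>pverts := V\<rparr>) M N"
proof -
  let ?R = "reconfig_reachable (G\<lparr>pverts := V\<rparr>)"
  have without_p: "?R A B" if A: "mds V A" "p \<notin> A" and B: "mds V B" "p \<notin> B" for A B
  proof -
    have "reconfig_reachable (G\<lparr>pverts := V - L - {p}\<rparr>) (A - L) (B - L)"
      using A B p_in by (intro IH mds_Diff_leaves) auto
    then have "?R ((A - L) \<union> L) ((B - L) \<union> L)"
      by (rule reconfig_reachable_Un[OF _ mds_Un_leaves]) auto
    with leaves_subset_mds[OF A] leaves_subset_mds[OF B] show ?thesis by (simp add: Un_absorb2)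
  qed
  have exchange: "\<exists>B. mds V B \<and> p \<notin> B \<and> ?R A B"
    if A: "mds V A" "p \<in> A"
      and "\<And>x. x \<in> V - L \<Longrightarrow> x \<in> nbhd G p \<Longrightarrow> \<exists>t \<in> A - {p}. x \<in> closed_nbhd G t" for A
    using mds_exchange[OF that] A p_notin
    by (intro exI[of _ "A - {p} \<union> L"]) (auto simp: reconfig_reachable_def)
  have remove_p: "\<exists>B. mds V B \<and> p \<notin> B \<and> ?R A B" if A: "mds V A" for A
  proof (cases "p \<in> A")
    case False
    with A show ?thesis by auto
  next
    case p: True
    show ?thesis
    proof (cases "\<exists>q \<in> V - L. q \<in> nbhd G p \<and> q \<notin> A")
      case False
      \<comment> \<open>Every neighbour of \<open>p\<close> outside \<open>L\<close> lies in
        \<open>A\<close> and dominates itself.\<close>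
      then show ?thesis
        using not_in_nbhd_self[of p] by (intro exchange A p) (force simp: closed_nbhd_def)
    next
      case True
      then obtain q where q: "q \<in> V - L" "q \<in> nbhd G p" "q \<notin> A" by auto
      have only_q: "\<And>x. x \<in> V - L \<Longrightarrow> x \<in> nbhd G p \<Longrightarrow> x = q" using only q by blast
      have "q \<noteq> p" using q not_in_nbhd_self by auto
      \<comment> \<open>A set \<open>K\<close> containing \<open>r\<close> dominates
        \<open>q\<close> without \<open>p\<close>, so the exchange is legal at
        \<open>K \<union> {p}\<close>.\<close>
      obtain r where r: "r \<in> V - {p}" "r \<in> nbhd G q" using nonleaf q by blast
      \<comment> \<open>\<open>r\<close> is no leaf of the star, since the only neighbour of such a
        leaf in \<open>V\<close> is \<open>p\<close>, not \<open>q\<close>.\<close>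
      have "r \<in> V - L - {p, q}"
        using r q \<open>q \<noteq> p\<close> leaf[of r q] nbhd_sym[of r q] not_in_nbhd_self[of q] by auto
      then obtain K where K: "mds (V - L - {p, q}) K" "r \<in> K"
        using ex_minimal_dominating_set_containing assms(1) by (meson finite_Diff)
      have "reconfig_reachable (G\<lparr>pverts := V - L - {p, q}\<rparr>) (A - {p}) K"
        using mds_Diff_centre[OF q(1,2) only_q A p q(3)] K p_in by (intro IH) auto
      then have "?R ((A - {p}) \<union> {p}) (K \<union> {p})"
        by (rule reconfig_reachable_Un[OF _ mds_insert_centre[OF q(1,2) only_q]]) auto
      then have AK: "?R A (K \<union> {p})" using p by (simp add: insert_absorb)
      have "\<exists>B. mds V B \<and> p \<notin> B \<and> ?R (K \<union> {p}) B"
      proof (rule exchange)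
        show "mds V (K \<union> {p})" by (rule mds_insert_centre[OF q(1,2) only_q K(1)])
        show "\<exists>t \<in> K \<union> {p} - {p}. x \<in> closed_nbhd G t"
          if "x \<in> V - L" "x \<in> nbhd G p" for x
          using only_q[OF that] K(2) r nbhd_sym[of r q] by (auto simp: closed_nbhd_def)
      qed simp
      with AK show ?thesis by (blast intro: reconfig_reachable_trans)
    qed
  qed
  obtain A B where "mds V A" "p \<notin> A" "?R M A" "mds V B" "p \<notin> B" "?R N B"
    using remove_p assms(5,6) by blast
  then show ?thesis
    using without_p reconfig_reachable_trans reconfig_reachable_sym by metis
qed

end

section \<open>Forests\<close>

context pair_graph
begin

text \<open>Otherwise the first vertex of a longest path in \<open>W\<close> has a neighbour in
  \<open>W\<close> besides its successor. By maximality this neighbour is on the path and closes a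
  cycle.\<close>

lemma undirected_forest_degenerate:
  assumes forest: "undirected_forest G" and "W \<subseteq> pverts G" "W \<noteq> {}"
  shows "\<exists>p \<in> W. \<forall>x \<in> W. \<forall>y \<in> W. x \<in> nbhd G p \<longrightarrow> y \<in> nbhd G p \<longrightarrow> x = y"
proof (rule ccontr)
  assume "\<not> ?thesis"
  then have two: "\<exists>x \<in> W. x \<in> nbhd G p \<and> x \<noteq> y" if "p \<in> W" for p y
    using that by metis
  have finW: "finite W" using assms(2) pair_finite_verts finite_subset by blast
  let ?P = "\<lambda>xs. xs \<noteq> [] \<and> distinct xs \<and> set xs \<subseteq> W \<and> set (vwalk_arcs xs) \<subseteq> parcs G"
  obtain w where "w \<in> W" using assms(3) by auto
  then have "?P [w]" by simp
  moreover have "\<forall>xs. ?P xs \<longrightarrow> length xs < Suc (card W)"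
    using finW by (metis card_mono distinct_card less_Suc_eq_le)
  ultimately obtain xs where xs: "?P xs" and max: "\<forall>ys. ?P ys \<longrightarrow> length ys \<le> length xs"
    using ex_has_greatest_nat[of ?P "[w]" length "Suc (card W)"] by blast
  obtain x xs' where xs': "xs = x # xs'" using xs by (cases xs) auto
  then have "x \<in> W" using xs by auto
  then obtain z where z: "z \<in> W" "z \<in> nbhd G x" "xs' \<noteq> [] \<longrightarrow> z \<noteq> hd xs'" using two by blast
  have zx: "(z, x) \<in> parcs G" using z by (auto simp: nbhd_def intro: arcs_symmetric)
  have "\<not> ?P (z # xs)" using max by fastforce
  then have "z \<in> set xs" using xs z zx xs' by auto
  then have "z \<in> set xs'" using z(2) xs' not_in_nbhd_self by auto
  then obtain ys zs where s: "xs' = ys @ z # zs" by (auto dest: split_list)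
  then have ys: "ys \<noteq> []" using z(3) by auto
  \<comment> \<open>As \<open>ys\<close> is nonempty, \<open>?c\<close> has at least three arcs and
    does not just go back and forth along one edge.\<close>
  let ?c = "z # x # ys @ [z]"
  have "set (vwalk_arcs (x # ys @ [z])) \<subseteq> set (vwalk_arcs xs)"
    using set_vwalk_arcs_append1[of "x # ys @ [z]" zs] s xs' by simp
  then have arcs: "set (vwalk_arcs ?c) \<subseteq> parcs G" using xs zx by auto
  have walk: "awalk u (vwalk_arcs (u # us)) (last (u # us)) \<and> awalk_verts u (vwalk_arcs (u # us)) = u # us"
    if "set (vwalk_arcs (u # us)) \<subseteq> parcs G" "u \<in> pverts G" for u us
    using that
  proof (induction us arbitrary: u)
    case (Cons v us)
    then have "v \<in> pverts G" using in_arcsD2 by auto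
    with Cons show ?case by (auto simp: awalk_Cons_iff)
  qed (auto simp: awalk_Nil_iff)
  have "z \<in> pverts G" using z(1) assms(2) by auto
  from walk[OF arcs this] have "awalk z (vwalk_arcs ?c) z" "awalk_verts z (vwalk_arcs ?c) = ?c"
    by auto
  moreover have "distinct (tl ?c)" using xs xs' s by auto
  ultimately have "cycle (vwalk_arcs ?c)" unfolding cycle_def by auto
  moreover have "3 \<le> length (vwalk_arcs ?c)"
    using ys vwalk_length_simp[of ?c] unfolding vwalk_length_def by (cases ys) auto
  ultimately show False using forest unfolding undirected_forest_def by blast
qed

lemma reconfig_reachable_forest:
  assumes forest: "undirected_forest G" and "V \<subseteq> pverts G"
    and "minimal_dominating_set (G\<lparr>pverts := V\<rparr>) M" "minimal_dominating_set (G\<lparr>pverts := V\<rparr>) N"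
  shows "reconfig_reachable (G\<lparr>pverts := V\<rparr>) M N"
proof -
  have "finite V" using assms(2) pair_finite_verts finite_subset by blast
  then show ?thesis using assms(2-)
  proof (induction V arbitrary: M N rule: finite_psubset_induct)
    case (psubset V)
    let ?deg2 = "{v \<in> V. \<exists>x \<in> V. \<exists>y \<in> V. x \<in> nbhd G v \<and> y \<in> nbhd G v \<and> x \<noteq> y}"
    show ?case
    proof (cases "\<forall>x \<in> V. \<forall>y \<in> V. x \<notin> nbhd G y")
      case True
      \<comment> \<open>Without edges, every vertex can be dominated only by itself.\<close>
      have "K = V" if "minimal_dominating_set (G\<lparr>pverts := V\<rparr>) K" for K
        using that True unfolding minimal_dominating_set_pverts_update closed_nbhd_def by blast
      from this[OF psubset.prems(2)] this[OF psubset.prems(3)] show ?thesis by simp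
    next
      case False
      \<comment> \<open>A vertex of \<open>?deg2\<close> with at most one neighbour in \<open>?deg2\<close> must have a leaf neighbour.\<close>
      have "\<exists>p \<in> V. (\<exists>l \<in> V - ?deg2. l \<in> nbhd G p) \<and>
        (\<forall>x \<in> ?deg2. \<forall>y \<in> ?deg2. x \<in> nbhd G p \<longrightarrow> y \<in> nbhd G p \<longrightarrow> x = y)"
      proof (cases "?deg2 = {}")
        case True
        \<comment> \<open>Each component has at most one edge, so any end of an edge can serve as
          \<open>p\<close>.\<close>
        with False show ?thesis by blast
      next
        case False
        have "?deg2 \<subseteq> pverts G" using psubset.prems(1) by auto
        from undirected_forest_degenerate[OF forest this False]
        obtain p where p: "p \<in> ?deg2"
          and one: "\<forall>x \<in> ?deg2. \<forall>y \<in> ?deg2. x \<in> nbhd G p \<longrightarrow> y \<in> nbhd G p \<longrightarrow> x = y" by blast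
        from p obtain x y where "x \<in> V" "y \<in> V" "x \<in> nbhd G p" "y \<in> nbhd G p" "x \<noteq> y" by blast
        with one have "\<exists>l \<in> V - ?deg2. l \<in> nbhd G p" by blast
        with p one show ?thesis by blast
      qed
      then obtain p l where p: "p \<in> V" and l: "l \<in> V - ?deg2" "l \<in> nbhd G p"
        and one: "\<forall>x \<in> ?deg2. \<forall>y \<in> ?deg2. x \<in> nbhd G p \<longrightarrow> y \<in> nbhd G p \<longrightarrow> x = y" by blast
      \<comment> \<open>A vertex of \<open>L\<close> has no neighbour in \<open>V\<close> besides
        \<open>p\<close>. The other neighbours of \<open>p\<close> in \<open>V\<close> lie in
        \<open>?deg2\<close>: by \<open>one\<close> there is at most one, and its degree yields the
        hypothesis \<open>nonleaf\<close>.\<close>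
      define L where "L = {l \<in> V - ?deg2. l \<in> nbhd G p}"
      have deg2: "x \<in> ?deg2" if "x \<in> V - L" "x \<in> nbhd G p" for x
        using that by (auto simp: L_def)
      interpret pendant_star G V L p
      proof
        show "x \<in> nbhd G l \<longleftrightarrow> x = p" if "l \<in> L" "x \<in> V" for l x
          using that p nbhd_sym[of l p] unfolding L_def by blast
      qed (use p l not_in_nbhd_self in \<open>auto simp: L_def\<close>)
      show ?thesis
      proof (rule reconfig_reachable_step)
        show "x = y" if "x \<in> V - L" "x \<in> nbhd G p" "y \<in> V - L" "y \<in> nbhd G p" for x y
          using one deg2[OF that(1,2)] deg2[OF that(3,4)] that by blast
        show "\<exists>r \<in> V - {p}. r \<in> nbhd G x" if "x \<in> V - L" "x \<in> nbhd G p" for x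
          using deg2[OF that] by blast
      qed (use psubset in auto)
    qed
  qed
qed

end

section \<open>Connectedness of the reconfiguration graph\<close>

theorem theorem11:
  fixes G :: "'a pair_pre_digraph"
  assumes "pair_graph G"
    and "undirected_forest G"
  shows "Digraph_Component.connected (with_proj (reconfig_graph G))"
proof -
  interpret G: pair_graph G by (rule assms(1))
  interpret R: pair_graph "reconfig_graph G" by (rule pair_graph_reconfig_graph[OF assms(1)])
  have reach: "M \<rightarrow>\<^sup>*\<^bsub>with_proj (reconfig_graph G)\<^esub> N"
    if M: "minimal_dominating_set G M" and N: "minimal_dominating_set G N" for M N
  proof -
    have "reconfig_reachable G M N"
      using G.reconfig_reachable_forest[OF assms(2) order_refl] M N by simp
    then show ?thesis unfolding reconfig_reachable_def
    proof (induction rule: rtranclp_induct)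
      case base
      \<comment> \<open>Digraph reachability is reflexive only on vertices.\<close>
      have "M \<in> pverts (reconfig_graph G)" using M by (simp add: reconfig_graph_def)
      then show ?case by simp
    next
      case (step N K)
      then have "(N, K) \<in> parcs (reconfig_graph G)"
        by (auto simp: reconfig_graph_def)
      with step.IH show ?case by (rule R.reachable_adj_trans)
    qed
  qed
  have verts: "pverts (reconfig_graph G) = {M. minimal_dominating_set G M}"
    by (simp add: reconfig_graph_def)
  \<comment> \<open>Strong connectedness also demands a nonempty vertex set, hence the existence of
    a minimal dominating set.\<close>
  have "strongly_connected (mk_symmetric (with_proj (reconfig_graph G)))"
  proof (rule strongly_connectedI)
    show "verts (with_proj (mk_symmetric (with_proj (reconfig_graph G)))) \<noteq> {}"
      using G.ex_minimal_dominating_set[OF G.pair_finite_verts] by (simp add: verts)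
  qed (auto simp: verts intro!: R.reachable_mk_symmetricI reach)
  then show ?thesis by (simp add: connected_def)
qed

end
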